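(* Let $n$ be a positive integer. There exists an $(n,n)$-bounded 1-cross intersecting set pair system of size $5^{n/2}$ if $n$ is even, and of size $2\cdot 5^{(n-1)/2}$ if $n$ is odd.
   Context: A cross intersecting set pair system (SPS) of size $m\ge 2$ consists of finite sets $A_1,\dots,A_m$ and $B_1,\dots,B_m$ such that $A_i\cap B_i=\emptyset$ for every $1\le i\le m$ and $A_i\cap B_j\neq\emptyset$ for all $1\le i\neq j\le m$. It is $(a,b)$-bounded if $|A_i|\le a$ and $|B_i|\le b$ for each $i$. It is 1-cross intersecting if $|A_i\cap B_j|=1$ for each $i\neq j$. *)

theory Defs
  imports Main
begin

text \<open>A family \<open>A\<^sub>1, \<dots>, A\<^sub>m\<close> is a function on \<open>nat\<close>;
  only its values on \<open>{1..m}\<close> matter.\<close>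

definition cross_intersecting_SPS ::
    "nat \<Rightarrow> (nat \<Rightarrow> 'a set) \<Rightarrow> (nat \<Rightarrow> 'a set) \<Rightarrow> bool" where
  "cross_intersecting_SPS m A B \<longleftrightarrow>
     m \<ge> 2 \<and>
     (\<forall>i\<in>{1..m}. finite (A i) \<and> finite (B i)) \<and>
     (\<forall>i\<in>{1..m}. A i \<inter> B i = {}) \<and>
     (\<forall>i\<in>{1..m}. \<forall>j\<in>{1..m}. i \<noteq> j \<longrightarrow> A i \<inter> B j \<noteq> {})"

definition bounded_SPS ::
    "nat \<Rightarrow> nat \<Rightarrow> nat \<Rightarrow> (nat \<Rightarrow> 'a set) \<Rightarrow> (nat \<Rightarrow> 'a set) \<Rightarrow> bool" where
  "bounded_SPS a b m A B \<longleftrightarrow>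
     cross_intersecting_SPS m A B \<and>
     (\<forall>i\<in>{1..m}. card (A i) \<le> a \<and> card (B i) \<le> b)"

definition one_cross_intersecting_SPS ::
    "nat \<Rightarrow> (nat \<Rightarrow> 'a set) \<Rightarrow> (nat \<Rightarrow> 'a set) \<Rightarrow> bool" where
  "one_cross_intersecting_SPS m A B \<longleftrightarrow>
     cross_intersecting_SPS m A B \<and>
     (\<forall>i\<in>{1..m}. \<forall>j\<in>{1..m}. i \<noteq> j \<longrightarrow> card (A i \<inter> B j) = 1)"

end

theory Submission
  imports Defs "HOL-Library.Nat_Bijection"
begin

text \<open>
  The existence of bounded 1-cross intersecting systems is multiplicative. Let one system
  have \<open>m\<close> pairs and bounds \<open>(a, b)\<close>, and another one \<open>m'\<close> pairs and bounds \<open>(a', b')\<close>.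
  Attach to every index \<open>i\<close> of the first system its own copy of the second system, where the
  copies are disjoint from each other and from the first system, and take the pairs
  \<open>(A\<^sub>i \<union> A'\<^sub>i\<^sub>j, B\<^sub>i \<union> B'\<^sub>i\<^sub>j)\<close>, where \<open>(A'\<^sub>i\<^sub>j, B'\<^sub>i\<^sub>j)\<close> is the \<open>j\<close>-th
  pair of the \<open>i\<close>-th copy. Two such pairs with different \<open>i\<close> can only meet in the first system, and they do
  so in one point; two pairs with the same \<open>i\<close> and different \<open>j\<close> can only meet in the \<open>i\<close>-th
  copy, since \<open>A\<^sub>i \<inter> B\<^sub>i = {}\<close>, and again they meet in one point. So there are \<open>m m'\<close> pairs
  with bounds \<open>(a + a', b + b')\<close>.

  The theorem follows by taking products of copies of a \<open>(2,2)\<close>-bounded system of size 5 that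
  lives on the 5-cycle, with one further factor, the \<open>(1,1)\<close>-bounded system of size 2,
  when \<open>n\<close> is odd.
\<close>

definition one_cross_SPS_exists :: "nat \<Rightarrow> nat \<Rightarrow> nat \<Rightarrow> bool" where
  "one_cross_SPS_exists a b m \<longleftrightarrow>
     (\<exists>A B :: nat \<Rightarrow> nat set. bounded_SPS a b m A B \<and> one_cross_intersecting_SPS m A B)"

lemma one_cross_SPS_existsI:
  fixes A B :: "nat \<Rightarrow> nat set"
  assumes "m \<ge> 2"
    and "\<And>i. i \<in> {1..m} \<Longrightarrow> finite (A i) \<and> finite (B i)"
    and "\<And>i. i \<in> {1..m} \<Longrightarrow> card (A i) \<le> a \<and> card (B i) \<le> b"
    and "\<And>i. i \<in> {1..m} \<Longrightarrow> A i \<inter> B i = {}"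
    and one: "\<And>i j. i \<in> {1..m} \<Longrightarrow> j \<in> {1..m} \<Longrightarrow> i \<noteq> j \<Longrightarrow> card (A i \<inter> B j) = 1"
  shows "one_cross_SPS_exists a b m"
proof -
  have "A i \<inter> B j \<noteq> {}" if "i \<in> {1..m}" "j \<in> {1..m}" "i \<noteq> j" for i j
    using one[OF that] by (metis card.empty zero_neq_one)
  then have "bounded_SPS a b m A B \<and> one_cross_intersecting_SPS m A B"
    unfolding bounded_SPS_def one_cross_intersecting_SPS_def cross_intersecting_SPS_def
    using assms by blast
  then show ?thesis
    unfolding one_cross_SPS_exists_def by blast
qed

lemma one_cross_SPS_props:
  assumes "bounded_SPS a b m A B" and "one_cross_intersecting_SPS m A B"
  shows "m \<ge> 2"
    and "\<And>i. i \<in> {1..m} \<Longrightarrow> finite (A i) \<and> finite (B i)"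
    and "\<And>i. i \<in> {1..m} \<Longrightarrow> card (A i) \<le> a \<and> card (B i) \<le> b"
    and "\<And>i. i \<in> {1..m} \<Longrightarrow> A i \<inter> B i = {}"
    and "\<And>i j. i \<in> {1..m} \<Longrightarrow> j \<in> {1..m} \<Longrightarrow> i \<noteq> j \<Longrightarrow> card (A i \<inter> B j) = 1"
  using assms
  by (simp_all add: bounded_SPS_def one_cross_intersecting_SPS_def cross_intersecting_SPS_def)

lemma one_cross_SPS_singletons: "one_cross_SPS_exists 1 1 2"
proof (rule one_cross_SPS_existsI[where A = "\<lambda>i. {i}" and B = "\<lambda>i. {3 - i}"])
  fix i j :: nat
  assume "i \<in> {1..2}" and "j \<in> {1..2}" and "i \<noteq> j"
  then have "3 - j = i"
    by auto
  then show "card ({i} \<inter> {3 - j}) = 1"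
    by simp
qed (auto, presburger)

text \<open>
  On the 5-cycle let \<open>A\<^sub>i\<close> be the edge \<open>{i, i + 1}\<close>. The three vertices outside \<open>A\<^sub>i\<close> form the
  path \<open>i + 2, i + 3, i + 4\<close>, and its two ends cover each of the other four edges
  exactly once.
\<close>

lemma one_cross_SPS_pentagon: "one_cross_SPS_exists 2 2 5"
proof (rule one_cross_SPS_existsI
    [where A = "\<lambda>i. {i mod 5, (i + 1) mod 5}" and B = "\<lambda>i. {(i + 2) mod 5, (i + 4) mod 5}"])
  have range: "{1..5} = {1, 2, 3, 4, 5 :: nat}"
    by auto
  fix i :: nat
  assume "i \<in> {1..5}"
  then have i: "i \<in> {1, 2, 3, 4, 5}"
    by (simp only: range)
  then show "{i mod 5, (i + 1) mod 5} \<inter> {(i + 2) mod 5, (i + 4) mod 5} = {}"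
    by auto
  fix j :: nat
  assume "j \<in> {1..5}" and neq: "i \<noteq> j"
  then have "j \<in> {1, 2, 3, 4, 5}"
    by (simp only: range)
  with i neq show "card ({i mod 5, (i + 1) mod 5} \<inter> {(j + 2) mod 5, (j + 4) mod 5}) = 1"
    by (elim insertE emptyE) (simp_all add: Int_insert_left)
qed (simp_all add: card_insert_le_m1)

text \<open>
  The disjoint copies are realised inside the natural numbers by tagging with
  \<^const>\<open>prod_encode\<close>: tag 0 marks the first system and tag \<open>i \<ge> 1\<close> the copy of the second
  system that belongs to \<open>i\<close>. The index set \<open>{1..m * m'}\<close> is identified with
  \<open>{1..m} \<times> {1..m'}\<close> through division with remainder by \<open>m'\<close>.
\<close>

lemma one_cross_SPS_product:
  assumes "one_cross_SPS_exists a b m" and "one_cross_SPS_exists a' b' m'"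
  shows "one_cross_SPS_exists (a + a') (b + b') (m * m')"
proof -
  obtain A B :: "nat \<Rightarrow> nat set"
    where sys: "bounded_SPS a b m A B" "one_cross_intersecting_SPS m A B"
    using assms(1) unfolding one_cross_SPS_exists_def by blast
  note m = one_cross_SPS_props(1)[OF sys]
    and fin = one_cross_SPS_props(2)[OF sys]
    and bound = one_cross_SPS_props(3)[OF sys]
    and disj = one_cross_SPS_props(4)[OF sys]
    and one = one_cross_SPS_props(5)[OF sys]
  obtain A' B' :: "nat \<Rightarrow> nat set"
    where sys': "bounded_SPS a' b' m' A' B'" "one_cross_intersecting_SPS m' A' B'"
    using assms(2) unfolding one_cross_SPS_exists_def by blast
  note m' = one_cross_SPS_props(1)[OF sys']
    and fin' = one_cross_SPS_props(2)[OF sys']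
    and bound' = one_cross_SPS_props(3)[OF sys']
    and disj' = one_cross_SPS_props(4)[OF sys']
    and one' = one_cross_SPS_props(5)[OF sys']
  define q where "q k = (k - 1) div m' + 1" for k
  define r where "r k = (k - 1) mod m' + 1" for k
  have q: "q k \<in> {1..m}" and r: "r k \<in> {1..m'}" if "k \<in> {1..m * m'}" for k
  proof -
    have "k - 1 < m * m'"
      using that by auto
    then show "q k \<in> {1..m}"
      by (simp add: q_def less_mult_imp_div_less Suc_leI)
    show "r k \<in> {1..m'}"
      using m' by (simp add: r_def Suc_leI)
  qed
  have index_inj: "k = l"
    if "k \<in> {1..m * m'}" "l \<in> {1..m * m'}" "q k = q l" "r k = r l" for k l
  proof -
    have "k - 1 = l - 1"
      using that(3,4) unfolding q_def r_def by (metis add_right_cancel div_mult_mod_eq)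
    then show ?thesis
      using that(1,2) by auto
  qed
  define tag where "tag t X = (\<lambda>x. prod_encode (t, x)) ` X" for t and X :: "nat set"
  have tag_fin: "finite (tag t X)" if "finite X" for t X
    using that by (simp add: tag_def)
  have tag_card: "card (tag t X) = card X" for t X
    unfolding tag_def by (rule card_image) (simp add: inj_on_def)
  have tag_Int: "tag t X \<inter> tag u Y = (if t = u then tag t (X \<inter> Y) else {})" for t u X Y
    by (auto simp: tag_def)
  have tag_empty: "tag t {} = {}" for t
    by (simp add: tag_def)
  define C where "C k = tag 0 (A (q k)) \<union> tag (q k) (A' (r k))" for k
  define D where "D k = tag 0 (B (q k)) \<union> tag (q k) (B' (r k))" for k
  have CD: "C k \<inter> D l = tag 0 (A (q k) \<inter> B (q l)) \<union>
      (if q k = q l then tag (q k) (A' (r k) \<inter> B' (r l)) else {})" for k l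
  proof -
    have "q i \<noteq> 0" "0 \<noteq> q i" for i
      by (simp_all add: q_def)
    note q_nonzero = this
    show ?thesis
      by (simp add: C_def D_def Int_Un_distrib Int_Un_distrib2 tag_Int q_nonzero del: neq0_conv)
  qed
  show ?thesis
  proof (rule one_cross_SPS_existsI[where A = C and B = D])
    show "m * m' \<ge> 2"
      using mult_le_mono[OF m m'] by simp
  next
    fix k assume k: "k \<in> {1..m * m'}"
    show "finite (C k) \<and> finite (D k)"
      using fin[OF q[OF k]] fin'[OF r[OF k]] by (simp add: C_def D_def tag_fin)
    show "card (C k) \<le> a + a' \<and> card (D k) \<le> b + b'"
      unfolding C_def D_def using bound[OF q[OF k]] bound'[OF r[OF k]]
      by (metis (no_types) add_mono card_Un_le order_trans tag_card)
    show "C k \<inter> D k = {}"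
      using disj[OF q[OF k]] disj'[OF r[OF k]] by (simp add: CD tag_empty)
    fix l assume l: "l \<in> {1..m * m'}" and neq: "k \<noteq> l"
    show "card (C k \<inter> D l) = 1"
    proof (cases "q k = q l")
      case True
      then have "r k \<noteq> r l"
        using index_inj[OF k l] neq by blast
      then show ?thesis
        using True disj[OF q[OF l]] one'[OF r[OF k] r[OF l]]
        by (simp add: CD tag_empty tag_card)
    next
      case False
      then show ?thesis
        using one[OF q[OF k] q[OF l]] by (simp add: CD tag_card)
    qed
  qed
qed

lemma one_cross_SPS_power:
  assumes "one_cross_SPS_exists a b m"
  shows "one_cross_SPS_exists (Suc k * a) (Suc k * b) (m ^ Suc k)"
proof (induction k)
  case 0
  then show ?case
    using assms by simp
next
  case (Suc k)
  then show ?case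
    using one_cross_SPS_product[OF assms Suc] by simp
qed

theorem corollary1p2:
  fixes n :: nat
  assumes "n > 0"
  shows "(even n \<longrightarrow>
            (\<exists>A B :: nat \<Rightarrow> nat set.
               bounded_SPS n n (5 ^ (n div 2)) A B \<and>
               one_cross_intersecting_SPS (5 ^ (n div 2)) A B)) \<and>
         (odd n \<longrightarrow>
            (\<exists>A B :: nat \<Rightarrow> nat set.
               bounded_SPS n n (2 * 5 ^ ((n - 1) div 2)) A B \<and>
               one_cross_intersecting_SPS (2 * 5 ^ ((n - 1) div 2)) A B))"
proof -
  have pentagons: "one_cross_SPS_exists (2 * k) (2 * k) (5 ^ k)" if "k > 0" for k
    using one_cross_SPS_power[OF one_cross_SPS_pentagon, of "k - 1"] that
    by (simp add: mult.commute)
  have "one_cross_SPS_exists n n (5 ^ (n div 2))" if "even n"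
    using pentagons[of "n div 2"] that assms by auto
  moreover have "one_cross_SPS_exists n n (2 * 5 ^ ((n - 1) div 2))" if "odd n"
  proof -
    obtain k where n: "n = 2 * k + 1"
      using \<open>odd n\<close> by (rule oddE)
    show ?thesis
    proof (cases "k = 0")
      (* A system has at least two pairs, so there is no empty product of pentagons. *)
      case True
      then show ?thesis
        using one_cross_SPS_singletons n by simp
    next
      case False
      then show ?thesis
        using one_cross_SPS_product[OF one_cross_SPS_singletons pentagons[of k]] n by simp
    qed
  qed
  ultimately show ?thesis
    unfolding one_cross_SPS_exists_def by blast
qed

end
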